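(* Let $n\geq 1$ and let $L$ be a real $n\times n$ matrix such that $\sum_{j=1}^n L_{i,j}=0$ for every $i$. Let $\mathcal{G}$ be the set of $n\times n$ Markov generators. Define $B\in\mathcal{G}$ by $B_{i,j}=L_{i,j}$ if $i\neq j$ and $L_{i,j}\geq 0$, and $B_{i,j}=0$ if $i\neq j$ and $L_{i,j}<0$, together with the constraint $\sum_{j=1}^n B_{i,j}=0$ for all $i$ (which determines the diagonal entries $B_{i,i}$). Then $$\Vert L-B\Vert=\min\{\Vert L-G\Vert : G\in\mathcal{G}\}.$$
   Context: An $n\times n$ Markov generator is a real $n\times n$ matrix $G$ such that $\sum_{j=1}^n G_{i,j}=0$ for every $i$ and $G_{i,j}\geq 0$ whenever $i\neq j$. The matrix norm is $\Vert M\Vert=\max\{\Vert Mv\Vert_\infty:\Vert v\Vert_\infty\leq 1\}=\max_{1\leq i\leq n}\sum_{j=1}^n|M_{i,j}|$. *)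

theory Defs
  imports "HOL-Analysis.Analysis"
begin

definition markov_generators :: "(real ^ 'n ^ 'n) set" where
  "markov_generators =
     {G. (\<forall>i. (\<Sum>j\<in>UNIV. G $ i $ j) = 0) \<and> (\<forall>i j. i \<noteq> j \<longrightarrow> G $ i $ j \<ge> 0)}"

text \<open>The operator norm induced by the maximum norm on vectors. The library's \<^const>\<open>onorm\<close>
  and \<^const>\<open>norm\<close> are Euclidean here. The supremum is a maximum, and it is the largest
  absolute row sum: see \<open>linf_opnorm_attained\<close> and \<open>linf_opnorm_eq_Max\<close>.\<close>

definition linf_opnorm :: "real ^ 'n ^ 'm \<Rightarrow> real" where
  "linf_opnorm M = (SUP v\<in>{v. infnorm v \<le> 1}. infnorm (M *v v))"

text \<open>Negative off-diagonal entries are set to 0; the diagonal is the one forced by vanishing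
  row sums, as \<open>eq_nonneg_part_generator_iff\<close> confirms.\<close>

definition nonneg_part_generator :: "real ^ 'n ^ 'n \<Rightarrow> real ^ 'n ^ 'n" where
  "nonneg_part_generator L =
     (\<chi> i j. if i \<noteq> j then (if L $ i $ j \<ge> 0 then L $ i $ j else 0)
             else - (\<Sum>k\<in>UNIV - {i}. if L $ i $ k \<ge> 0 then L $ i $ k else 0))"

lemma eq_nonneg_part_generator_iff:
  "B = nonneg_part_generator L \<longleftrightarrow>
     (\<forall>i j. i \<noteq> j \<and> L $ i $ j \<ge> 0 \<longrightarrow> B $ i $ j = L $ i $ j) \<and>
     (\<forall>i j. i \<noteq> j \<and> L $ i $ j < 0 \<longrightarrow> B $ i $ j = 0) \<and>
     (\<forall>i. (\<Sum>j\<in>UNIV. B $ i $ j) = 0)" (is "_ \<longleftrightarrow> ?C")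
proof
  have row: "(\<Sum>j\<in>UNIV. A $ i $ j) = A $ i $ i + (\<Sum>j\<in>UNIV - {i}. A $ i $ j)"
    for A :: "real ^ 'a ^ 'a" and i
    by (simp add: sum.remove)
  {
    assume "B = nonneg_part_generator L"
    then show ?C
      by (auto simp only: row) (auto simp: nonneg_part_generator_def intro!: sum.cong)
  next
    assume C: ?C
    have off: "B $ i $ j = (if L $ i $ j \<ge> 0 then L $ i $ j else 0)" if "i \<noteq> j" for i j
      using C that by (simp add: not_le)
    have "B $ i $ i = - (\<Sum>k\<in>UNIV - {i}. if L $ i $ k \<ge> 0 then L $ i $ k else 0)" for i
    proof -
      have "(\<Sum>k\<in>UNIV - {i}. B $ i $ k) = (\<Sum>k\<in>UNIV - {i}. if L $ i $ k \<ge> 0 then L $ i $ k else 0)"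
        by (rule sum.cong) (auto simp: off)
      then show ?thesis
        using C row[of B i] by simp
    qed
    then show "B = nonneg_part_generator L"
      by (simp add: vec_eq_iff nonneg_part_generator_def off)
  }
qed

lemma infnorm_eq_Max_cart: "infnorm (x :: real ^ 'n) = (MAX i. \<bar>x $ i\<bar>)"
proof -
  have "{\<bar>x $ i\<bar> |i. i \<in> UNIV} = range (\<lambda>i. \<bar>x $ i\<bar>)"
    by auto
  then show ?thesis
    by (simp add: infnorm_cart cSup_eq_Max)
qed

lemma infnorm_mult_le_row_sum:
  fixes M :: "real ^ 'n ^ 'm"
  assumes "infnorm v \<le> 1"
  shows "infnorm (M *v v) \<le> (MAX i. \<Sum>j\<in>UNIV. \<bar>M $ i $ j\<bar>)"
proof -
  have v: "\<bar>v $ j\<bar> \<le> 1" for j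
    using assms by (simp add: infnorm_eq_Max_cart)
  have "\<bar>(M *v v) $ i\<bar> \<le> (MAX i. \<Sum>j\<in>UNIV. \<bar>M $ i $ j\<bar>)" for i
  proof -
    have "\<bar>(M *v v) $ i\<bar> \<le> (\<Sum>j\<in>UNIV. \<bar>M $ i $ j * v $ j\<bar>)"
      by (simp add: matrix_vector_mult_def)
    also have "\<dots> \<le> (\<Sum>j\<in>UNIV. \<bar>M $ i $ j\<bar>)"
      by (rule sum_mono) (simp add: abs_mult mult_left_le v)
    also have "\<dots> \<le> (MAX i. \<Sum>j\<in>UNIV. \<bar>M $ i $ j\<bar>)"
      by simp
    finally show ?thesis .
  qed
  then show ?thesis
    by (simp add: infnorm_eq_Max_cart[of "M *v v"])
qed

lemma row_sum_attained:
  fixes M :: "real ^ 'n ^ 'm"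
  shows "\<exists>v. infnorm v \<le> 1 \<and> infnorm (M *v v) = (MAX i. \<Sum>j\<in>UNIV. \<bar>M $ i $ j\<bar>)"
proof -
  let ?R = "range (\<lambda>i. \<Sum>j\<in>UNIV. \<bar>M $ i $ j\<bar>)"
  have "Max ?R \<in> ?R"
    by (rule Max_in) auto
  then obtain i where i: "Max ?R = (\<Sum>j\<in>UNIV. \<bar>M $ i $ j\<bar>)"
    unfolding image_iff by blast
  define v :: "real ^ 'n" where "v = (\<chi> j. sgn (M $ i $ j))"
  have v: "infnorm v \<le> 1"
    by (simp add: infnorm_eq_Max_cart v_def abs_sgn_eq)
  have "Max ?R = (M *v v) $ i"
    unfolding i by (simp add: matrix_vector_mult_def v_def abs_sgn)
  also have "\<dots> \<le> \<bar>(M *v v) $ i\<bar>"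
    by simp
  also have "\<dots> \<le> infnorm (M *v v)"
    by (simp add: component_le_infnorm_cart)
  finally show ?thesis
    using v infnorm_mult_le_row_sum[OF v, of M] by (intro exI[of _ v] conjI antisym)
qed

lemma linf_opnorm_eq_Max:
  "linf_opnorm (M :: real ^ 'n ^ 'm) = (MAX i. \<Sum>j\<in>UNIV. \<bar>M $ i $ j\<bar>)"
  unfolding linf_opnorm_def
proof (rule cSup_eq_maximum)
  show "(MAX i. \<Sum>j\<in>UNIV. \<bar>M $ i $ j\<bar>) \<in> (\<lambda>v. infnorm (M *v v)) ` {v. infnorm v \<le> 1}"
    using row_sum_attained[of M] by force
qed (auto intro: infnorm_mult_le_row_sum)

lemma linf_opnorm_attained:
  "\<exists>v. infnorm v \<le> 1 \<and> infnorm (M *v v) = linf_opnorm (M :: real ^ 'n ^ 'm)"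
  by (simp add: linf_opnorm_eq_Max row_sum_attained)

end

theory Submission
  imports Defs
begin

text \<open>A row of zero sum has absolute sum \<open>\<Sum>j. (\<bar>x j\<bar> - x j)\<close>, and \<open>\<bar>x\<bar> - x\<close> is nonincreasing
  in \<open>x\<close>. This gives an entrywise comparison of \<open>L - B\<close> with \<open>L - G\<close>: off the diagonal \<open>L - B\<close>
  is the negative part of \<open>L\<close>, while \<open>L - G \<le> L\<close>; on the diagonal \<open>L - B\<close> is nonnegative, so its
  term vanishes.\<close>

lemma nonneg_part_generator_off_diag:
  "i \<noteq> j \<Longrightarrow> nonneg_part_generator L $ i $ j = max (L $ i $ j) 0"
  by (simp add: nonneg_part_generator_def max_def)

lemma sum_nonneg_part_generator: "(\<Sum>j\<in>UNIV. nonneg_part_generator L $ i $ j) = 0"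
  using eq_nonneg_part_generator_iff[of "nonneg_part_generator L" L] by simp

lemma nonneg_part_generator_in_markov_generators:
  "nonneg_part_generator L \<in> markov_generators"
  by (simp add: markov_generators_def sum_nonneg_part_generator nonneg_part_generator_off_diag)

text \<open>Passing from \<open>L\<close> to its generator can only raise off-diagonal entries; as
  both rows sum to zero, the diagonal entry can only drop.\<close>

lemma nonneg_part_generator_diag_le:
  assumes "(\<Sum>j\<in>UNIV. L $ i $ j) = 0"
  shows "nonneg_part_generator L $ i $ i \<le> L $ i $ i"
proof -
  have "(\<Sum>j\<in>UNIV - {i}. L $ i $ j) \<le> (\<Sum>j\<in>UNIV - {i}. nonneg_part_generator L $ i $ j)"
    by (rule sum_mono) (simp add: nonneg_part_generator_off_diag)
  then show ?thesis
    using assms sum_nonneg_part_generator[of L i] by (simp add: sum.remove[of UNIV i])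
qed

lemma row_sum_diff_nonneg_part_generator_le:
  assumes L: "(\<Sum>j\<in>UNIV. L $ i $ j) = 0" and G: "G \<in> markov_generators"
  shows "(\<Sum>j\<in>UNIV. \<bar>(L - nonneg_part_generator L) $ i $ j\<bar>) \<le> (\<Sum>j\<in>UNIV. \<bar>(L - G) $ i $ j\<bar>)"
proof -
  let ?B = "nonneg_part_generator L"
  have row: "(\<Sum>j\<in>UNIV. \<bar>(L - A) $ i $ j\<bar>) = (\<Sum>j\<in>UNIV. \<bar>(L - A) $ i $ j\<bar> - (L - A) $ i $ j)"
    if "A \<in> markov_generators" for A
    using that L by (simp add: markov_generators_def sum_subtractf)
  have "\<bar>(L - ?B) $ i $ j\<bar> - (L - ?B) $ i $ j \<le> \<bar>(L - G) $ i $ j\<bar> - (L - G) $ i $ j" for j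
  proof (cases "j = i")
    case True
    then show ?thesis
      using nonneg_part_generator_diag_le[of L i, OF L] by simp
  next
    case False
    then have "G $ i $ j \<ge> 0"
      using G by (simp add: markov_generators_def)
    \<comment> \<open>If \<open>L $ i $ j\<close> is negative, the two sides are
      \<open>- 2 * L $ i $ j\<close> and \<open>2 * (G $ i $ j - L $ i $ j)\<close>; otherwise the
      left side is 0.\<close>
    with False show ?thesis
      by (simp add: nonneg_part_generator_off_diag max_def abs_if)
  qed
  then show ?thesis
    unfolding row[OF G] row[OF nonneg_part_generator_in_markov_generators] by (rule sum_mono)
qed

text \<open>Lets the minimization be done in each row separately, since the norm is the largest
  absolute row sum.\<close>

lemma linf_opnorm_mono_row_sum:
  fixes M N :: "real ^ 'n ^ 'm"
  assumes "\<And>i. (\<Sum>j\<in>UNIV. \<bar>M $ i $ j\<bar>) \<le> (\<Sum>j\<in>UNIV. \<bar>N $ i $ j\<bar>)"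
  shows "linf_opnorm M \<le> linf_opnorm N"
  unfolding linf_opnorm_eq_Max by (rule Max.boundedI) (auto intro: order_trans[OF assms])

theorem theorem12:
  fixes L :: "real ^ 'n ^ 'n"
  assumes "\<forall>i. (\<Sum>j\<in>UNIV. L $ i $ j) = 0"
  shows "nonneg_part_generator L \<in> markov_generators \<and>
         (\<forall>G\<in>markov_generators. linf_opnorm (L - nonneg_part_generator L) \<le> linf_opnorm (L - G))"
  using assms
  by (blast intro: nonneg_part_generator_in_markov_generators linf_opnorm_mono_row_sum
      row_sum_diff_nonneg_part_generator_le)

end
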